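(* Let $\varepsilon>0$ and let $Q$ be a finite poset of height $h(Q)\ge 2$. For every finite poset $P$, if $t(Q,P) < \left(\frac{\varepsilon}{2}\right)^{h(Q)\,w(Q)^2}$, then there exists a $Q$-free (moreover, $C_{h(Q)}$-free) subposet of $P$ obtained by the removal of at most $\varepsilon |P|^2$ edges.
   Context: A poset is a set with an anti-reflexive, transitive relation $\prec$; it is regarded as a digraph whose edges are the pairs $(x,y)$ with $x\prec y$. $|P|$ is the number of elements of $P$. The height $h(P)$ is the number of elements of a longest chain of $P$, and the width $w(P)$ is the size of a largest antichain of $P$. $C_h$ is the chain with $h$ elements. A map $f:Q\to P$ is a homomorphism if $f(x)\prec f(y)$ whenever $x\prec y$. $t(Q,P)$ is the probability that a uniformly random mapping from $Q$ to $P$ is a homomorphism. Subposets are not necessarily induced: a subposet of $P$ obtained by the removal of edges is a poset on the same set of elements whose edge set is obtained from that of $P$ by deleting those edges. $P$ is $Q$-free if it does not contain $Q$ as a (not necessarily induced) subposet, i.e. there is no injective homomorphism $Q\to P$. *)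

theory Defs
  imports "HOL-Probability.Probability"
begin

text \<open>
  A poset is given by its carrier \<open>V\<close> and its strict order \<open>E\<close>, the latter being the edge set
  of the associated digraph.
\<close>

definition poset :: "'a set \<Rightarrow> 'a rel \<Rightarrow> bool" where
  "poset V E \<longleftrightarrow> E \<subseteq> V \<times> V \<and> irrefl E \<and> trans E"

definition chain_in :: "'a set \<Rightarrow> 'a rel \<Rightarrow> 'a set \<Rightarrow> bool" where
  "chain_in V E C \<longleftrightarrow> C \<subseteq> V \<and> total_on C E"

definition antichain_in :: "'a set \<Rightarrow> 'a rel \<Rightarrow> 'a set \<Rightarrow> bool" where
  "antichain_in V E A \<longleftrightarrow> A \<subseteq> V \<and> (\<forall>x\<in>A. \<forall>y\<in>A. (x, y) \<notin> E)"

text \<open>Height and width are meant for finite carriers, where the maximum is over a finite set.\<close>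

definition poset_height :: "'a set \<Rightarrow> 'a rel \<Rightarrow> nat" where
  "poset_height V E = Max (card ` {C. chain_in V E C})"

definition poset_width :: "'a set \<Rightarrow> 'a rel \<Rightarrow> nat" where
  "poset_width V E = Max (card ` {A. antichain_in V E A})"

definition poset_hom :: "'a set \<Rightarrow> 'a rel \<Rightarrow> 'b set \<Rightarrow> 'b rel \<Rightarrow> ('a \<Rightarrow> 'b) \<Rightarrow> bool" where
  "poset_hom V E W F f \<longleftrightarrow> f \<in> V \<rightarrow> W \<and> (\<forall>x y. (x, y) \<in> E \<longrightarrow> (f x, f y) \<in> F)"

text \<open>
  Mappings from \<open>V\<close> to \<open>W\<close> are represented by the extensional functions \<open>V \<rightarrow>\<^sub>E W\<close>, so that each
  mapping is counted once. If \<open>W\<close> is empty and \<open>V\<close> is not, there is no mapping and the value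
  is unspecified.
\<close>

definition hom_density :: "'a set \<Rightarrow> 'a rel \<Rightarrow> 'b set \<Rightarrow> 'b rel \<Rightarrow> real" where
  "hom_density V E W F =
     measure_pmf.prob (pmf_of_set (V \<rightarrow>\<^sub>E W)) {f. poset_hom V E W F f}"

text \<open>The poset \<open>(W, F)\<close> contains no copy, induced or not, of \<open>(V, E)\<close>.\<close>

definition poset_free :: "'a set \<Rightarrow> 'a rel \<Rightarrow> 'b set \<Rightarrow> 'b rel \<Rightarrow> bool" where
  "poset_free V E W F \<longleftrightarrow> \<not> (\<exists>f. poset_hom V E W F f \<and> inj_on f V)"

text \<open>The strict order of the \<open>h\<close>-element chain with carrier \<open>{..<h}\<close>.\<close>

definition chain_rel :: "nat \<Rightarrow> nat rel" where
  "chain_rel h = {(i, j). i < j \<and> j < h}"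

end

theory Submission
  imports Defs
begin

text \<open>
  Write \<open>n\<close> for the number of elements of \<open>P\<close>, \<open>h\<close> and \<open>w\<close> for the height and width of \<open>Q\<close>, and
  \<open>\<delta> = \<epsilon> / 2\<close>. In \<open>P\<close>, form decreasing sets \<open>L 0 = P, L 1, L 2, \<dots>\<close>, where \<open>y\<close> belongs to
  \<open>L (k + 1)\<close> if at least \<open>\<delta> n\<close> elements of \<open>L k\<close> lie below \<open>y\<close>. By transitivity each \<open>L k\<close> is
  closed upwards. There are two cases, according to the size of \<open>L (h - 1)\<close>.

  If \<open>L (h - 1)\<close> has at most \<open>\<delta> n\<close> elements, then assign to each element one of \<open>h - 1\<close> levels,
  namely the last of \<open>L 0, \<dots>, L (h - 2)\<close> that contains it, and delete all edges along which the level
  does not increase. What remains is a poset that has no chain of \<open>h\<close> elements, hence no copy of \<open>Q\<close>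
  either. An element outside \<open>L (h - 1)\<close> loses at most \<open>\<delta> n\<close> incoming edges, because they
  come from the last \<open>L k\<close> that contains the element; an element of \<open>L (h - 1)\<close> loses at most \<open>n\<close>,
  but such elements are rare. Altogether at most \<open>2 \<delta> n\<^sup>2 = \<epsilon> n\<^sup>2\<close> edges are deleted
  (\<open>removal_if_top_rich_small\<close>).

  If \<open>L (h - 1)\<close> has more than \<open>\<delta> n\<close> elements, there are many homomorphisms
  (\<open>hom_density_ge_if_top_rich_large\<close>). Split \<open>Q\<close> into its ranks, which are antichains of
  sizes \<open>m 0, \<dots>, m (h - 1)\<close>, all at most \<open>w\<close>, and count the maps that send all of rank \<open>i\<close> below
  all of rank \<open>i + 1\<close> for every \<open>i\<close>. Such maps are built from the top rank downwards. The
  point is to keep, at every stage, the freedom of choosing the images of rank \<open>k\<close> independently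
  from a set \<open>D\<close> contained in \<open>L k\<close>: whatever \<open>D\<close> is, every element of \<open>D\<close> has \<open>\<delta> n\<close> predecessors
  in \<open>L (k - 1)\<close>, so by convexity \<open>m k\<close> independent elements of \<open>D\<close> have on average at least
  \<open>\<delta> ^ m k * n\<close> common predecessors in \<open>L (k - 1)\<close>, and these common predecessors are
  the next set \<open>D\<close>. A second use of convexity, for the power \<open>m (k - 1)\<close>, shows that passing from
  rank \<open>k\<close> to rank \<open>k - 1\<close> costs a factor \<open>\<delta> ^ (m k * m (k - 1))\<close>, at worst \<open>\<delta> ^ w\<^sup>2\<close>
  (\<open>card_layered_maps_ge\<close>). The choice of the top rank inside \<open>L (h - 1)\<close> costs at most
  \<open>\<delta> ^ w\<close>, so the density is at least \<open>\<delta> ^ (h * w\<^sup>2)\<close>.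
\<close>

section \<open>Levels, height and width of a finite poset\<close>

lemma card_chain_le_height:
  assumes "finite V" "chain_in V E C"
  shows "card C \<le> poset_height V E"
proof -
  have "finite {C. chain_in V E C}"
    by (rule finite_subset[of _ "Pow V"]) (use assms in \<open>auto simp: chain_in_def\<close>)
  then show ?thesis
    unfolding poset_height_def using assms(2) by (intro Max_ge) auto
qed

lemma card_antichain_le_width:
  assumes "finite V" "antichain_in V E A"
  shows "card A \<le> poset_width V E"
proof -
  have "finite {A. antichain_in V E A}"
    by (rule finite_subset[of _ "Pow V"]) (use assms in \<open>auto simp: antichain_in_def\<close>)
  then show ?thesis
    unfolding poset_width_def using assms(2) by (intro Max_ge) auto
qed

lemma obtain_chain_of_height:
  assumes "finite V"
  obtains C where "chain_in V E C" "card C = poset_height V E"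
proof -
  have fin: "finite {C. chain_in V E C}"
    by (rule finite_subset[of _ "Pow V"]) (use assms in \<open>auto simp: chain_in_def\<close>)
  have "{} \<in> {C. chain_in V E C}"
    by (auto simp: chain_in_def total_on_def)
  then have "card ` {C. chain_in V E C} \<noteq> {}"
    by blast
  then have "poset_height V E \<in> card ` {C. chain_in V E C}"
    unfolding poset_height_def using fin by (intro Max_in) auto
  then obtain C where "poset_height V E = card C" "C \<in> {C. chain_in V E C}"
    by (rule imageE)
  then show thesis
    using that by simp
qed

definition rank :: "'a rel \<Rightarrow> 'a \<Rightarrow> nat" where
  "rank E x = poset_height {y. (y, x) \<in> E} E"

lemma finite_predecessors:
  assumes "finite V" "poset V E"
  shows "finite {y. (y, x) \<in> E}"
  by (rule finite_subset[of _ V]) (use assms in \<open>auto simp: poset_def\<close>)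

text \<open>
  A longest chain strictly below \<open>x\<close> can be extended by \<open>x\<close> itself. This chain shows both that
  ranks stay below the height and that they increase strictly along edges.
\<close>

lemma obtain_chain_to:
  assumes "finite V" "poset V E" "x \<in> V"
  obtains C where "C \<subseteq> insert x {y. (y, x) \<in> E}" "chain_in V E C" "card C = Suc (rank E x)"
proof -
  obtain C where C: "chain_in {y. (y, x) \<in> E} E C" "card C = rank E x"
    unfolding rank_def using obtain_chain_of_height[OF finite_predecessors[OF assms(1,2)]] .
  have "x \<notin> C"
    using C(1) assms(2) by (auto simp: chain_in_def poset_def irrefl_def)
  moreover have "finite C"
    using C(1) finite_predecessors[OF assms(1,2)] by (meson chain_in_def finite_subset)
  ultimately have "card (insert x C) = Suc (rank E x)"
    using C(2) by simp
  moreover have "chain_in V E (insert x C)"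
    using C(1) assms(2,3) unfolding chain_in_def total_on_def poset_def by blast
  moreover have "insert x C \<subseteq> insert x {y. (y, x) \<in> E}"
    using C(1) by (auto simp: chain_in_def)
  ultimately show thesis
    using that by blast
qed

lemma rank_less_height:
  assumes "finite V" "poset V E" "x \<in> V"
  shows "rank E x < poset_height V E"
  using obtain_chain_to[OF assms] card_chain_le_height[OF assms(1)]
  by (metis Suc_le_lessD)

lemma rank_strict_mono:
  assumes "finite V" "poset V E" "(x, y) \<in> E"
  shows "rank E x < rank E y"
proof -
  have "x \<in> V"
    using assms by (auto simp: poset_def)
  from obtain_chain_to[OF assms(1,2) this]
  obtain C where C: "C \<subseteq> insert x {z. (z, x) \<in> E}" "chain_in V E C" "card C = Suc (rank E x)" .
  have "C \<subseteq> {z. (z, y) \<in> E}"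
    using C(1) assms(2,3) by (auto simp: poset_def dest: transD)
  then have "chain_in {z. (z, y) \<in> E} E C"
    using C(2) by (simp add: chain_in_def)
  from card_chain_le_height[OF finite_predecessors[OF assms(1,2)] this] C(3)
  show ?thesis
    by (simp add: rank_def)
qed

lemma card_rank_level_le_width:
  assumes "finite V" "poset V E"
  shows "card {x \<in> V. rank E x = i} \<le> poset_width V E"
  using rank_strict_mono[OF assms]
  by (intro card_antichain_le_width assms) (fastforce simp: antichain_in_def)

text \<open>The ranks along a longest chain are distinct, so they exhaust all values below the height.\<close>

lemma rank_level_nonempty:
  assumes "finite V" "poset V E" "i < poset_height V E"
  shows "\<exists>x\<in>V. rank E x = i"
proof -
  obtain C where C: "chain_in V E C" "card C = poset_height V E"
    using obtain_chain_of_height[OF assms(1)] .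
  have "inj_on (rank E) C"
    using C(1) rank_strict_mono[OF assms(1,2)]
    unfolding inj_on_def chain_in_def total_on_def by (metis less_irrefl)
  then have "card (rank E ` C) = card {..<poset_height V E}"
    using C(2) by (simp add: card_image)
  moreover have "rank E ` C \<subseteq> {..<poset_height V E}"
    using C(1) rank_less_height[OF assms(1,2)] by (auto simp: chain_in_def)
  ultimately have "rank E ` C = {..<poset_height V E}"
    by (intro card_subset_eq) auto
  then have "i \<in> rank E ` C"
    using assms(3) by simp
  then show ?thesis
    using C(1) by (auto simp: chain_in_def)
qed

text \<open>
  A homomorphism followed by the strictly increasing function \<open>level\<close> is injective on chains. Used
  for \<open>Q\<close> itself and, with the whole carrier as \<open>C\<close>, for the chain of the same height.
\<close>

lemma poset_free_if_graded:
  fixes level :: "'b \<Rightarrow> nat"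
  assumes "chain_in V E C" "m < card C"
    and "\<And>x. x \<in> W \<Longrightarrow> level x < m"
    and "\<And>x y. (x, y) \<in> F \<Longrightarrow> level x < level y"
  shows "poset_free V E W F"
  unfolding poset_free_def
proof
  assume "\<exists>f. poset_hom V E W F f \<and> inj_on f V"
  then obtain f where f: "poset_hom V E W F f"
    by blast
  have "inj_on (level \<circ> f) C"
    using assms(1,4) f unfolding inj_on_def chain_in_def total_on_def poset_hom_def comp_def
    by (metis less_irrefl)
  moreover have "(level \<circ> f) ` C \<subseteq> {..<m}"
    using assms(1,3) f by (auto simp: chain_in_def poset_hom_def)
  ultimately have "card C \<le> card {..<m}"
    by (meson card_inj_on_le finite_lessThan)
  then show False
    using assms(2) by simp
qed

section \<open>Rich levels and the removal of edges\<close>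

text \<open>
  The parameter \<open>t\<close> is the least number of predecessors in one level that is needed to enter the
  next one.
\<close>

fun rich :: "'b set \<Rightarrow> 'b rel \<Rightarrow> real \<Rightarrow> nat \<Rightarrow> 'b set" where
  "rich V E t 0 = V"
| "rich V E t (Suc k) = {y \<in> V. t \<le> real (card {x \<in> rich V E t k. (x, y) \<in> E})}"

lemma rich_subset: "rich V E t k \<subseteq> V"
  by (cases k) auto

lemma finite_rich: "finite V \<Longrightarrow> finite (rich V E t k)"
  using rich_subset finite_subset by metis

lemma rich_upward_closed:
  assumes "finite V" "poset V E" "(x, y) \<in> E" "x \<in> rich V E t k"
  shows "y \<in> rich V E t k"
proof (cases k)
  case 0
  then show ?thesis
    using assms(2,3) by (auto simp: poset_def)
next
  case (Suc j)
  have "card {z \<in> rich V E t j. (z, x) \<in> E} \<le> card {z \<in> rich V E t j. (z, y) \<in> E}"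
    using assms(2,3) by (intro card_mono) (auto simp: finite_rich[OF assms(1)] poset_def dest: transD)
  moreover have "y \<in> V"
    using assms(2,3) by (auto simp: poset_def)
  ultimately show ?thesis
    using assms(4) Suc by auto
qed

text \<open>
  The edges are counted by their upper end \<open>y\<close>. If \<open>y\<close> is outside the top rich level, too few
  elements of equal level are below \<open>y\<close>; the others are at most \<open>t\<close> in number, and the trivial
  bound on their in-degree suffices. The levels stop at \<open>m\<close>, one before the top rich level,
  because one more level would allow a chain that is too long.
\<close>

lemma removal_if_top_rich_small:
  assumes V: "finite V" "poset V E" and t: "0 \<le> t"
    and small: "real (card (rich V E t (Suc m))) \<le> t"
  obtains E' :: "'b rel" and level :: "'b \<Rightarrow> nat"
  where "E' \<subseteq> E" "poset V E'" "real (card (E - E')) \<le> 2 * t * real (card V)"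
    "\<forall>x. level x < Suc m" "\<forall>x y. (x, y) \<in> E' \<longrightarrow> level x < level y"
proof -
  let ?L = "rich V E t"
  \<comment> \<open>As the rich levels decrease, \<open>level x\<close> is the last index up to \<open>m\<close> of a rich level that
    contains \<open>x\<close>. Defined as a cardinality, it reduces comparisons to inclusions.\<close>
  define K where "K x = {k. 1 \<le> k \<and> k \<le> m \<and> x \<in> ?L k}" for x
  define level where "level x = card (K x)" for x
  define E' where "E' = {(x, y) \<in> E. level x < level y}"
  have K: "K x \<subseteq> {1..m}" for x
    by (auto simp: K_def)
  have finK: "finite (K x)" for x
    using K finite_subset by blast
  have "level x < Suc m" for x
    using card_mono[OF _ K[of x]] by (simp add: level_def)
  then have "\<forall>x. level x < Suc m"
    by blast
  moreover have "E' \<subseteq> E" "\<forall>x y. (x, y) \<in> E' \<longrightarrow> level x < level y"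
    by (auto simp: E'_def)
  moreover have "poset V E'"
    using V(2) unfolding poset_def E'_def irrefl_def trans_def by (auto intro: less_trans)
  moreover have "real (card (E - E')) \<le> 2 * t * real (card V)"
  proof -
    define In where "In y = {x. (x, y) \<in> E - E'}" for y
    have In_V: "In y \<subseteq> V" for y
      using V(2) by (auto simp: In_def poset_def)
    have removed: "K x = K y" if "x \<in> In y" for x y
    proof -
      have "(x, y) \<in> E" "level y \<le> level x"
        using that by (auto simp: In_def E'_def)
      moreover from this have "K x \<subseteq> K y"
        unfolding K_def using rich_upward_closed[OF V] by auto
      ultimately show ?thesis
        unfolding level_def by (intro card_seteq finK)
    qed
    have few: "real (card (In y)) \<le> t" if "y \<in> V" "y \<notin> ?L (Suc m)" for y
    proof -
      \<comment> \<open>\<open>k\<close> is the place where \<open>y\<close> first fails; the sources of the edges removed at \<open>y\<close> survive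
        up to \<open>k\<close> like \<open>y\<close> does, and then too few of them lie in the level \<open>k\<close>.\<close>
      have "\<exists>k\<le>m. y \<in> ?L k \<and> y \<notin> ?L (Suc k)"
      proof (rule ccontr)
        assume no: "\<not> ?thesis"
        have "k \<le> Suc m \<Longrightarrow> y \<in> ?L k" for k
        proof (induction k)
          case 0
          then show ?case using that(1) by simp
        next
          case (Suc k)
          then show ?case using no by (meson Suc_leD Suc_le_mono)
        qed
        then show False
          using that(2) by blast
      qed
      then obtain k where k: "k \<le> m" "y \<in> ?L k" "y \<notin> ?L (Suc k)"
        by blast
      have "In y \<subseteq> {x \<in> ?L k. (x, y) \<in> E}"
      proof
        fix x assume x: "x \<in> In y"
        have "x \<in> ?L k"
        proof (cases "k = 0")
          case True
          then show ?thesis using x In_V by auto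
        next
          case False
          then have "k \<in> K x"
            unfolding removed[OF x] using k by (simp add: K_def)
          then show ?thesis by (simp add: K_def)
        qed
        then show "x \<in> {x \<in> ?L k. (x, y) \<in> E}"
          using x by (simp add: In_def)
      qed
      then have "card (In y) \<le> card {x \<in> ?L k. (x, y) \<in> E}"
        by (intro card_mono) (auto simp: finite_rich[OF V(1)])
      moreover have "real (card {x \<in> ?L k. (x, y) \<in> E}) < t"
        using k(3) that(1) by auto
      ultimately show ?thesis
        by linarith
    qed
    let ?T = "?L (Suc m)"
    have T: "?T \<subseteq> V"
      by (rule rich_subset)
    have "bij_betw prod.swap (SIGMA y:V. In y) (E - E')"
      by (rule bij_betwI[where g = prod.swap])
        (use V(2) in \<open>auto simp: In_def poset_def\<close>)
    then have "card (E - E') = card (SIGMA y:V. In y)"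
      by (simp add: bij_betw_same_card)
    also have "\<dots> = (\<Sum>y\<in>V. card (In y))"
      using V(1) In_V finite_subset by (intro card_SigmaI) blast+
    also have "\<dots> = (\<Sum>y\<in>?T. card (In y)) + (\<Sum>y\<in>V - ?T. card (In y))"
      using sum.subset_diff[OF T V(1)] by (simp add: add.commute)
    finally have "real (card (E - E'))
        = (\<Sum>y\<in>?T. real (card (In y))) + (\<Sum>y\<in>V - ?T. real (card (In y)))"
      by simp
    also have "\<dots> \<le> (\<Sum>y\<in>?T. real (card V)) + (\<Sum>y\<in>V - ?T. t)"
      using few card_mono[OF V(1) In_V]
      by (intro add_mono sum_mono) auto
    also have "\<dots> = real (card ?T) * real (card V) + real (card (V - ?T)) * t"
      by simp
    also have "\<dots> \<le> t * real (card V) + real (card V) * t"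
      using small t V(1) by (intro add_mono mult_right_mono) (auto intro: card_mono)
    finally show ?thesis
      by simp
  qed
  ultimately show thesis
    using that by blast
qed

section \<open>Counting homomorphisms into rich levels\<close>

text \<open>Jensen's inequality for the uniform distribution on \<open>A\<close>.\<close>

lemma power_mean_sum:
  fixes a :: "'i \<Rightarrow> real"
  assumes "finite A" "\<And>i. i \<in> A \<Longrightarrow> 0 \<le> a i"
  shows "real (card A) * (sum a A / real (card A)) ^ m \<le> (\<Sum>i\<in>A. a i ^ m)"
proof (cases "A = {}")
  case False
  let ?n = "real (card A)"
  have n: "?n > 0"
    using False assms(1) by (simp add: card_gt_0_iff)
  have conv: "convex_on {0::real..} (\<lambda>x. x ^ m)"
    using convex_power_odd convex_power_even
    by (cases "odd m") (auto intro: convex_on_subset)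
  have "(\<Sum>i\<in>A. (1 / ?n) *\<^sub>R a i) ^ m \<le> (\<Sum>i\<in>A. (1 / ?n) * a i ^ m)"
    using n by (intro convex_on_sum[OF assms(1) False conv]) (auto simp: assms(2))
  then have "(sum a A / ?n) ^ m \<le> (\<Sum>i\<in>A. a i ^ m) / ?n"
    by (simp add: sum_divide_distrib)
  then show ?thesis
    using n by (simp add: field_simps)
qed auto

text \<open>
  Both sides count pairs of an element \<open>x\<close> and a map \<open>g\<close> into its upper neighbourhood \<open>N x\<close>. For a
  fixed \<open>x\<close> there are \<open>card (N x) ^ card M\<close> such maps, and the degree condition bounds the mean of
  \<open>card (N x)\<close> over \<open>V\<close> from below, so convexity applies. The mean is taken over \<open>V\<close> and
  not over \<open>A\<close>: the terms outside \<open>A\<close> vanish because \<open>M\<close> is nonempty.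
\<close>

lemma sum_card_common_in_neighbours:
  assumes V: "finite V" "A \<subseteq> V" and M: "finite M" "M \<noteq> {}" and D: "finite D" and d: "0 \<le> d"
    and deg: "\<And>y. y \<in> D \<Longrightarrow> d * real (card V) \<le> real (card {x \<in> A. (x, y) \<in> E})"
  shows "real (card V) * (d * real (card D)) ^ card M
    \<le> (\<Sum>g \<in> M \<rightarrow>\<^sub>E D. real (card {x \<in> A. \<forall>q\<in>M. (x, g q) \<in> E}))"
proof (cases "V = {}")
  case False
  let ?n = "real (card V)"
  define N where "N x = {y \<in> D. x \<in> A \<and> (x, y) \<in> E}" for x
  have n: "?n > 0"
    using False V(1) by (simp add: card_gt_0_iff)
  have A: "finite A"
    using V finite_subset by blast
  have finG: "finite (M \<rightarrow>\<^sub>E D)"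
    using M(1) D by (simp add: finite_PiE)
  have "d * real (card D) * ?n = (\<Sum>y\<in>D. d * ?n)"
    by simp
  also have "\<dots> \<le> (\<Sum>y\<in>D. real (card {x \<in> A. (x, y) \<in> E}))"
    by (intro sum_mono deg)
  also have "\<dots> = (\<Sum>y\<in>D. \<Sum>x\<in>V. of_bool (x \<in> A \<and> (x, y) \<in> E))"
    using V A by (intro sum.cong refl) (auto simp: Collect_conj_eq intro!: arg_cong[of _ _ card])
  also have "\<dots> = (\<Sum>x\<in>V. \<Sum>y\<in>D. of_bool (x \<in> A \<and> (x, y) \<in> E))"
    by (rule sum.swap)
  also have "\<dots> = (\<Sum>x\<in>V. real (card (N x)))"
    using D by (simp add: N_def Collect_conj_eq Int_commute Int_assoc)
  finally have avg: "d * real (card D) \<le> (\<Sum>x\<in>V. real (card (N x))) / ?n"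
    using n by (simp add: field_simps)
  have "?n * (d * real (card D)) ^ card M \<le> ?n * ((\<Sum>x\<in>V. real (card (N x))) / ?n) ^ card M"
    using avg n d by (intro mult_left_mono power_mono) auto
  also have "\<dots> \<le> (\<Sum>x\<in>V. real (card (N x)) ^ card M)"
    by (intro power_mean_sum V) auto
  also have "\<dots> = (\<Sum>x\<in>V. real (card (M \<rightarrow>\<^sub>E N x)))"
    using M(1) by (simp add: card_funcsetE)
  also have "\<dots> = (\<Sum>x\<in>V. \<Sum>g\<in>M \<rightarrow>\<^sub>E D. of_bool (x \<in> A \<and> (\<forall>q\<in>M. (x, g q) \<in> E)))"
  proof (intro sum.cong refl)
    fix x
    have "M \<rightarrow>\<^sub>E N x = (M \<rightarrow>\<^sub>E D) \<inter> {g. x \<in> A \<and> (\<forall>q\<in>M. (x, g q) \<in> E)}"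
      using M(2) by (auto simp: N_def PiE_iff)
    then show "real (card (M \<rightarrow>\<^sub>E N x))
        = (\<Sum>g\<in>M \<rightarrow>\<^sub>E D. of_bool (x \<in> A \<and> (\<forall>q\<in>M. (x, g q) \<in> E)))"
      using finG by simp
  qed
  also have "\<dots> = (\<Sum>g\<in>M \<rightarrow>\<^sub>E D. \<Sum>x\<in>V. of_bool (x \<in> A \<and> (\<forall>q\<in>M. (x, g q) \<in> E)))"
    by (rule sum.swap)
  also have "\<dots> = (\<Sum>g \<in> M \<rightarrow>\<^sub>E D. real (card {x \<in> A. \<forall>q\<in>M. (x, g q) \<in> E}))"
  proof (intro sum.cong refl)
    fix g
    have "V \<inter> {x. x \<in> A \<and> (\<forall>q\<in>M. (x, g q) \<in> E)} = {x \<in> A. \<forall>q\<in>M. (x, g q) \<in> E}"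
      using V(2) by blast
    then show "(\<Sum>x\<in>V. of_bool (x \<in> A \<and> (\<forall>q\<in>M. (x, g q) \<in> E)))
        = real (card {x \<in> A. \<forall>q\<in>M. (x, g q) \<in> E})"
      using V(1) by simp
  qed
  finally show ?thesis .
qed (simp add: sum_nonneg)

text \<open>
  Partial homomorphisms on the ranks up to \<open>k\<close>. The images of one rank are required to lie
  below all images of the next one, whether or not the source relates the elements, so that the
  images of one rank constrain those of the rank below only through their set of common
  predecessors. Only the top rank is confined to \<open>D\<close>.
\<close>

definition layered_maps ::
    "'a set \<Rightarrow> ('a \<Rightarrow> nat) \<Rightarrow> 'b set \<Rightarrow> 'b rel \<Rightarrow> nat \<Rightarrow> 'b set \<Rightarrow> ('a \<Rightarrow> 'b) set" where
  "layered_maps Q r V E k D = {f \<in> {q \<in> Q. r q \<le> k} \<rightarrow>\<^sub>E V.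
     (\<forall>q\<in>Q. r q = k \<longrightarrow> f q \<in> D) \<and>
     (\<forall>q\<in>Q. \<forall>q'\<in>Q. Suc (r q) = r q' \<and> r q' \<le> k \<longrightarrow> (f q, f q') \<in> E)}"

lemma finite_layered_maps:
  assumes "finite Q" "finite V"
  shows "finite (layered_maps Q r V E k D)"
proof (rule finite_subset)
  show "layered_maps Q r V E k D \<subseteq> {q \<in> Q. r q \<le> k} \<rightarrow>\<^sub>E V"
    by (auto simp: layered_maps_def)
  show "finite ({q \<in> Q. r q \<le> k} \<rightarrow>\<^sub>E V)"
    using assms by (intro finite_PiE) auto
qed

text \<open>
  A map \<open>g\<close> on rank \<open>k + 1\<close> can be joined with any map on the lower ranks that sends rank \<open>k\<close> to
  common predecessors of the values of \<open>g\<close>. Restricting to those in \<open>A\<close>, later a rich level,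
  only loses maps.
\<close>

lemma layered_maps_extend:
  fixes Q :: "'a set" and r :: "'a \<Rightarrow> nat" and k :: nat
  assumes fin: "finite Q" "finite V" and D: "D \<subseteq> V"
  defines "M \<equiv> {q \<in> Q. r q = Suc k}"
  shows "(\<Sum>g \<in> M \<rightarrow>\<^sub>E D. card (layered_maps Q r V E k {x \<in> A. \<forall>q\<in>M. (x, g q) \<in> E}))
    \<le> card (layered_maps Q r V E (Suc k) D)"
proof -
  let ?X = "\<lambda>g. {x \<in> A. \<forall>q\<in>M. (x, g q) \<in> E}"
  let ?S = "SIGMA g:M \<rightarrow>\<^sub>E D. layered_maps Q r V E k (?X g)"
  let ?join = "\<lambda>(g, f) q. if q \<in> M then g q else f q"
  have finG: "finite (M \<rightarrow>\<^sub>E D)"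
    using fin D by (intro finite_PiE) (auto simp: M_def intro: finite_subset)
  have "inj_on ?join ?S"
  proof (rule inj_onI, clarify)
    fix g f g' f'
    assume g: "g \<in> M \<rightarrow>\<^sub>E D" "g' \<in> M \<rightarrow>\<^sub>E D"
      and f: "f \<in> layered_maps Q r V E k (?X g)" "f' \<in> layered_maps Q r V E k (?X g')"
      and eq: "(\<lambda>q. if q \<in> M then g q else f q) = (\<lambda>q. if q \<in> M then g' q else f' q)"
    have eq': "(if q \<in> M then g q else f q) = (if q \<in> M then g' q else f' q)" for q
      using eq by (rule fun_cong)
    have "g q = g' q" for q
      using eq'[of q] PiE_arb[OF g(1), of q] PiE_arb[OF g(2), of q] by (cases "q \<in> M") simp_all
    moreover have "f q = f' q" for q
    proof (cases "q \<in> M")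
      case True
      then have "q \<notin> {q \<in> Q. r q \<le> k}"
        by (simp add: M_def)
      moreover have "f \<in> {q \<in> Q. r q \<le> k} \<rightarrow>\<^sub>E V" "f' \<in> {q \<in> Q. r q \<le> k} \<rightarrow>\<^sub>E V"
        using f by (simp_all only: layered_maps_def mem_Collect_eq)
      ultimately show ?thesis
        by (metis PiE_arb)
    qed (use eq'[of q] in simp)
    ultimately show "g = g' \<and> f = f'"
      by blast
  qed
  moreover have "?join ` ?S \<subseteq> layered_maps Q r V E (Suc k) D"
  proof clarify
    fix g f
    assume g: "g \<in> M \<rightarrow>\<^sub>E D" and f: "f \<in> layered_maps Q r V E k (?X g)"
    have fE: "f \<in> {q \<in> Q. r q \<le> k} \<rightarrow>\<^sub>E V"
      using f by (simp only: layered_maps_def mem_Collect_eq)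
    have fV: "f q \<in> V" if "q \<in> Q" "r q \<le> k" for q
      using PiE_mem[OF fE] that by simp
    have f_arb: "f q = undefined" if "\<not> (q \<in> Q \<and> r q \<le> k)" for q
      using PiE_arb[OF fE] that by simp
    have gD: "g q \<in> D" if "q \<in> M" for q
      using g that by auto
    have f_edge: "(f q, f q') \<in> E" if "q \<in> Q" "q' \<in> Q" "Suc (r q) = r q'" "r q' \<le> k" for q q'
      using f that by (auto simp: layered_maps_def)
    have f_top: "(f q, g q') \<in> E" if "q \<in> Q" "r q = k" "q' \<in> M" for q q'
      using f that by (auto simp: layered_maps_def)
    show "(\<lambda>q. if q \<in> M then g q else f q) \<in> layered_maps Q r V E (Suc k) D"
      unfolding layered_maps_def
    proof (intro CollectI conjI ballI impI PiE_I)
      fix q assume "q \<in> {q \<in> Q. r q \<le> Suc k}"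
      then show "(if q \<in> M then g q else f q) \<in> V"
        using gD D fV by (auto simp: M_def le_Suc_eq)
    next
      fix q assume "q \<notin> {q \<in> Q. r q \<le> Suc k}"
      then show "(if q \<in> M then g q else f q) = undefined"
        using f_arb by (auto simp: M_def)
    next
      fix q assume "q \<in> Q" "r q = Suc k"
      then show "(if q \<in> M then g q else f q) \<in> D"
        using gD by (auto simp: M_def)
    next
      fix q q' assume *: "q \<in> Q" "q' \<in> Q" "Suc (r q) = r q' \<and> r q' \<le> Suc k"
      then have "q \<notin> M"
        by (simp add: M_def)
      then show "(if q \<in> M then g q else f q, if q' \<in> M then g q' else f q') \<in> E"
        using * f_edge f_top by (auto simp: M_def le_Suc_eq)
    qed
  qed
  ultimately have "card ?S \<le> card (layered_maps Q r V E (Suc k) D)"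
    by (intro card_inj_on_le finite_layered_maps fin)
  then show ?thesis
    using finG finite_layered_maps[OF fin] by simp
qed

text \<open>
  Induction over the ranks for all sets \<open>D\<close> at once: after the images of rank \<open>k + 1\<close> are chosen,
  the lower ranks face the same problem with \<open>D\<close> replaced by the common predecessors of these
  images. The bound depends on \<open>D\<close> only through a power of its size, which is convex, so it
  is enough to know the average number of common predecessors.
\<close>

lemma card_layered_maps_ge:
  fixes Q :: "'a set" and r :: "'a \<Rightarrow> nat" and d :: real
  assumes Q: "finite Q" "\<And>i. i \<le> k \<Longrightarrow> \<exists>q\<in>Q. r q = i"
    and V: "finite V" and d: "0 \<le> d"
    and D: "D \<subseteq> rich V E (d * real (card V)) k"
  defines "m \<equiv> \<lambda>i. card {q \<in> Q. r q = i}"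
  shows "d ^ (\<Sum>i<k. m i * m (Suc i)) * real (card V) ^ (\<Sum>i<k. m i) * real (card D) ^ m k
    \<le> real (card (layered_maps Q r V E k D))"
  using Q(2) D
proof (induction k arbitrary: D)
  case 0
  have "{q \<in> Q. r q = 0} \<rightarrow>\<^sub>E D \<subseteq> layered_maps Q r V E 0 D"
    using 0 by (auto simp: layered_maps_def PiE_iff)
  then have "card ({q \<in> Q. r q = 0} \<rightarrow>\<^sub>E D) \<le> card (layered_maps Q r V E 0 D)"
    by (intro card_mono finite_layered_maps Q V)
  then show ?case
    using Q(1) by (simp add: card_funcsetE m_def flip: of_nat_power)
next
  case (Suc k)
  define n where "n = real (card V)"
  define c where "c = d ^ (\<Sum>i<k. m i * m (Suc i)) * n ^ (\<Sum>i<k. m i)"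
  define A where "A = rich V E (d * n) k"
  define M where "M = {q \<in> Q. r q = Suc k}"
  define X where "X g = {x \<in> A. \<forall>q\<in>M. (x, g q) \<in> E}" for g
  let ?G = "M \<rightarrow>\<^sub>E D"
  have DV: "D \<subseteq> V"
    using Suc.prems(2) rich_subset by (rule order_trans)
  then have finD: "finite D"
    using V by (rule finite_subset)
  have M: "finite M" "M \<noteq> {}" "card M = m (Suc k)"
    using Q(1) Suc.prems(1)[of "Suc k"] by (auto simp: M_def m_def)
  have G: "finite ?G" "real (card ?G) = real (card D) ^ m (Suc k)"
    using M finD by (auto simp: finite_PiE card_funcsetE)
  have c: "0 \<le> c"
    using d by (simp add: c_def n_def)
  have "real (card D) ^ m (Suc k) * (d ^ m (Suc k) * n) ^ m k
      \<le> real (card ?G) * ((\<Sum>g\<in>?G. real (card (X g))) / real (card ?G)) ^ m k"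
  proof (cases "D = {}")
    case True
    have "m (Suc k) > 0"
      using M by (metis card_gt_0_iff)
    then have "real (card D) ^ m (Suc k) = 0"
      using True by simp
    then show ?thesis
      by (simp only: G(2) mult_zero_left order_refl)
  next
    case False
    then have pos: "real (card ?G) > 0"
      using finD unfolding G(2) by (simp add: card_gt_0_iff)
    have "n * (d * real (card D)) ^ card M \<le> (\<Sum>g\<in>?G. real (card (X g)))"
      unfolding X_def n_def
    proof (rule sum_card_common_in_neighbours[OF V _ M(1,2) finD d])
      show "A \<subseteq> V"
        unfolding A_def by (rule rich_subset)
      show "d * real (card V) \<le> real (card {x \<in> A. (x, y) \<in> E})" if "y \<in> D" for y
        using that Suc.prems(2) unfolding A_def n_def by auto
    qed
    then have "d ^ m (Suc k) * n \<le> (\<Sum>g\<in>?G. real (card (X g))) / real (card ?G)"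
      using pos by (simp add: M(3) G(2) power_mult_distrib field_simps)
    then show ?thesis
      unfolding G(2) using d by (intro mult_left_mono power_mono) (auto simp: n_def)
  qed
  also have "\<dots> \<le> (\<Sum>g\<in>?G. real (card (X g)) ^ m k)"
    by (intro power_mean_sum G) auto
  finally have "c * (real (card D) ^ m (Suc k) * (d ^ m (Suc k) * n) ^ m k)
      \<le> c * (\<Sum>g\<in>?G. real (card (X g)) ^ m k)"
    using c by (intro mult_left_mono)
  also have "\<dots> = (\<Sum>g\<in>?G. c * real (card (X g)) ^ m k)"
    by (rule sum_distrib_left)
  also have "\<dots> \<le> (\<Sum>g\<in>?G. real (card (layered_maps Q r V E k (X g))))"
    unfolding c_def n_def
    by (intro sum_mono Suc.IH) (use Suc.prems(1) in \<open>auto simp: X_def A_def n_def\<close>)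
  also have "\<dots> \<le> real (card (layered_maps Q r V E (Suc k) D))"
    using layered_maps_extend[OF Q(1) V DV, where r = r and k = k and E = E and A = A]
    unfolding X_def M_def by (simp flip: of_nat_sum)
  also have "c * (real (card D) ^ m (Suc k) * (d ^ m (Suc k) * n) ^ m k)
      = d ^ (\<Sum>i<Suc k. m i * m (Suc i)) * n ^ (\<Sum>i<Suc k. m i) * real (card D) ^ m (Suc k)"
    by (simp add: c_def power_mult_distrib power_add mult_ac flip: power_mult)
  finally show ?case
    by (simp only: n_def)
qed

text \<open>
  Edges between consecutive ranks suffice: since no rank is skipped, transitivity of the target
  fills in all comparabilities between lower and higher ranks.
\<close>

lemma layered_map_is_hom:
  assumes Q: "\<And>i. i \<le> k \<Longrightarrow> \<exists>q\<in>Q. r q = i" "\<And>q. q \<in> Q \<Longrightarrow> r q \<le> k"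
    and F: "F \<subseteq> Q \<times> Q" "\<And>p q. (p, q) \<in> F \<Longrightarrow> r p < r q"
    and E: "trans E" and f: "f \<in> layered_maps Q r V E k D"
  shows "f \<in> Q \<rightarrow>\<^sub>E V" "poset_hom Q F V E f"
proof -
  have "{q \<in> Q. r q \<le> k} = Q"
    using Q(2) by auto
  then show fE: "f \<in> Q \<rightarrow>\<^sub>E V"
    using f by (simp add: layered_maps_def)
  have step: "(f p, f q) \<in> E" if "p \<in> Q" "q \<in> Q" "Suc (r p) = r q" for p q
    using f that Q(2)[OF that(2)] by (auto simp: layered_maps_def)
  have "(f p, f q) \<in> E" if "p \<in> Q" "q \<in> Q" "r q = Suc (r p + j)" for p q j
    using that
  proof (induction j arbitrary: q)
    case 0
    then show ?case using step by simp
  next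
    case (Suc j)
    then have "Suc (r p + j) \<le> k"
      using Q(2)[of q] by simp
    then obtain q' where q': "q' \<in> Q" "r q' = Suc (r p + j)"
      using Q(1) by blast
    then have "(f p, f q') \<in> E" "(f q', f q) \<in> E"
      using Suc step[of q' q] by auto
    then show ?case
      using E by (blast dest: transD)
  qed
  then have "(f p, f q) \<in> E" if "(p, q) \<in> F" for p q
    using that F less_imp_Suc_add by (metis SigmaD1 SigmaD2 add_Suc_right subsetD)
  then show "poset_hom Q F V E f"
    using fE by (auto simp: poset_hom_def)
qed

text \<open>
  The counting bound is applied with the whole top rich level as \<open>D\<close>. Largeness of that level
  also forces \<open>d \<le> 1\<close>, which lets the exact exponent be replaced by the larger one in terms
  of height and width.
\<close>

lemma hom_density_ge_if_top_rich_large: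
  fixes VQ :: "'a set" and EQ :: "'a rel" and d :: real
  assumes Q: "finite VQ" "poset VQ EQ" and h: "poset_height VQ EQ = Suc k"
    and P: "finite VP" "poset VP EP" and d: "0 \<le> d"
    and large: "d * real (card VP) < real (card (rich VP EP (d * real (card VP)) k))"
  shows "d ^ (poset_height VQ EQ * (poset_width VQ EQ)\<^sup>2) \<le> hom_density VQ EQ VP EP"
proof -
  define n where "n = real (card VP)"
  define L where "L = rich VP EP (d * n) k"
  define r where "r = rank EQ"
  define m where "m i = card {q \<in> VQ. r q = i}" for i
  define e where "e = (\<Sum>i<k. m i * m (Suc i))"
  let ?H = "layered_maps VQ r VP EP k L"
  let ?w = "poset_width VQ EQ"
  have large': "d * n < real (card L)"
    using large by (simp add: L_def n_def)
  have "card L \<le> card VP"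
    unfolding L_def by (intro card_mono P rich_subset)
  then have Ln: "real (card L) \<le> n"
    by (simp add: n_def)
  have "0 \<le> d * n"
    using d by (simp add: n_def)
  then have n: "n > 0"
    using large' Ln by linarith
  then have ne: "VP \<noteq> {}"
    by (auto simp: n_def)
  have d1: "d \<le> 1"
    using large' Ln n by (smt (verit) mult_less_cancel_right1)
  have rk: "r q \<le> k" if "q \<in> VQ" for q
    using rank_less_height[OF Q that] h by (simp add: r_def)
  have lev: "\<exists>q\<in>VQ. r q = i" if "i \<le> k" for i
    using rank_level_nonempty[OF Q] that h by (simp add: r_def)
  have mw: "m i \<le> ?w" for i
    unfolding m_def r_def by (rule card_rank_level_le_width[OF Q])

  \<comment> \<open>Of the \<open>k + 1\<close> summands \<open>w\<^sup>2\<close> of the final exponent, \<open>k\<close> pay for the pairs of consecutive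
    ranks and one for the top rank.\<close>
  have "m k \<ge> 1"
    using lev[of k] Q(1) by (auto simp: m_def Suc_le_eq card_gt_0_iff)
  with mw[of k] have w: "1 \<le> ?w"
    by linarith
  have "e \<le> (\<Sum>i<k. ?w * ?w)"
    unfolding e_def by (intro sum_mono mult_mono mw) auto
  moreover have "m k \<le> ?w * ?w"
    using mw[of k] w by (meson le_square le_trans)
  ultimately have "e + m k \<le> Suc k * ?w\<^sup>2"
    by (simp add: power2_eq_square)
  then have exponent: "d ^ (Suc k * ?w\<^sup>2) \<le> d ^ (e + m k)"
    using d d1 by (intro power_decreasing)

  have "(\<Sum>i\<le>k. m i) = card (\<Union>i\<in>{..k}. {q \<in> VQ. r q = i})"
    unfolding m_def using Q(1) by (subst card_UN_disjoint) auto
  also have "(\<Union>i\<in>{..k}. {q \<in> VQ. r q = i}) = VQ"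
    using rk by auto
  finally have cardQ: "(\<Sum>i<k. m i) + m k = card VQ"
    by (simp add: lessThan_Suc_atMost[symmetric])

  have "d ^ (e + m k) * n ^ card VQ
      = d ^ e * n ^ (\<Sum>i<k. m i) * (d * n) ^ m k"
    unfolding cardQ[symmetric] by (simp add: power_add power_mult_distrib)
  also have "\<dots> \<le> d ^ e * n ^ (\<Sum>i<k. m i) * real (card L) ^ m k"
    using large' d n by (intro mult_left_mono power_mono) auto
  also have "\<dots> \<le> real (card ?H)"
    unfolding e_def m_def n_def
    by (rule card_layered_maps_ge[OF Q(1) lev P(1) d]) (auto simp: L_def n_def)
  also have "\<dots> \<le> real (card ((VQ \<rightarrow>\<^sub>E VP) \<inter> {f. poset_hom VQ EQ VP EP f}))"
  proof -
    have "?H \<subseteq> (VQ \<rightarrow>\<^sub>E VP) \<inter> {f. poset_hom VQ EQ VP EP f}"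
    proof
      fix f assume "f \<in> ?H"
      with lev rk show "f \<in> (VQ \<rightarrow>\<^sub>E VP) \<inter> {f. poset_hom VQ EQ VP EP f}"
        using layered_map_is_hom[of k VQ r EQ EP f VP L] rank_strict_mono[OF Q] Q(2) P(2)
        by (auto simp: poset_def r_def)
    qed
    then show ?thesis
      using Q(1) P(1) by (auto intro!: card_mono finite_PiE)
  qed
  finally have "d ^ (e + m k) \<le> real (card ((VQ \<rightarrow>\<^sub>E VP) \<inter> {f. poset_hom VQ EQ VP EP f})) / n ^ card VQ"
    using n by (simp add: pos_le_divide_eq)
  also have "\<dots> = hom_density VQ EQ VP EP"
    unfolding hom_density_def using Q(1) P(1) ne
    by (subst measure_pmf_of_set) (auto simp: PiE_eq_empty_iff finite_PiE card_funcsetE n_def)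
  finally show ?thesis
    using exponent unfolding h by linarith
qed

section \<open>The removal lemma\<close>

theorem theorem1p1:
  fixes \<epsilon> :: real
    and VQ :: "'a set" and EQ :: "'a rel"
    and VP :: "'b set" and EP :: "'b rel"
  assumes "\<epsilon> > 0"
    and "finite VQ" and "poset VQ EQ" and "poset_height VQ EQ \<ge> 2"
    and "finite VP" and "poset VP EP"
    and "hom_density VQ EQ VP EP < (\<epsilon> / 2) ^ (poset_height VQ EQ * (poset_width VQ EQ)\<^sup>2)"
  shows "\<exists>E'. E' \<subseteq> EP \<and> poset VP E'
           \<and> real (card (EP - E')) \<le> \<epsilon> * (real (card VP))\<^sup>2
           \<and> poset_free VQ EQ VP E'
           \<and> poset_free {..<poset_height VQ EQ} (chain_rel (poset_height VQ EQ)) VP E'"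
proof -
  let ?h = "poset_height VQ EQ" and ?t = "\<epsilon> / 2 * real (card VP)"
  obtain m where h: "?h = Suc (Suc m)"
    using assms(4) by (metis One_nat_def Suc_1 Suc_le_D Suc_le_mono)
  have small: "real (card (rich VP EP ?t (Suc m))) \<le> ?t"
  proof (rule ccontr)
    assume "\<not> ?thesis"
    then have "(\<epsilon> / 2) ^ (?h * (poset_width VQ EQ)\<^sup>2) \<le> hom_density VQ EQ VP EP"
      using assms(1) by (intro hom_density_ge_if_top_rich_large[OF assms(2,3) h assms(5,6)]) auto
    then show False
      using assms(7) by linarith
  qed
  have "0 \<le> ?t"
    using assms(1) by simp
  from removal_if_top_rich_small[OF assms(5,6) this small] obtain E' and level :: "'b \<Rightarrow> nat"
    where E': "E' \<subseteq> EP" "poset VP E'" "real (card (EP - E')) \<le> 2 * ?t * real (card VP)"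
      and level: "\<forall>x. level x < Suc m" "\<forall>x y. (x, y) \<in> E' \<longrightarrow> level x < level y" .
  obtain C where "chain_in VQ EQ C" "card C = ?h"
    using obtain_chain_of_height[OF assms(2)] .
  then have "poset_free VQ EQ VP E'"
    using level h by (intro poset_free_if_graded[where m = "Suc m" and level = level]) auto
  moreover have "chain_in {..<?h} (chain_rel ?h) {..<?h}"
    by (auto simp: chain_in_def total_on_def chain_rel_def)
  then have "poset_free {..<?h} (chain_rel ?h) VP E'"
    using level h by (intro poset_free_if_graded[where m = "Suc m" and level = level]) auto
  moreover have "real (card (EP - E')) \<le> \<epsilon> * (real (card VP))\<^sup>2"
    using E'(3) by (simp add: power2_eq_square)
  ultimately show ?thesis
    using E'(1,2) by blast
qed

end
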